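(* Let $T:X\to X$ be a homeomorphism of the Polish space $(X,\tau_X)$, and assume that $X$ is endowed with a Hausdorff topology $\tau_1$ such that (I) $T$ is a continuous self-map of $(X,\tau_1)$; (II) $\tau_1\subset\tau_X$; (III* ) every point of $X$ has a neighbourhood basis for $\tau_X$ consisting of $\tau_1$-compact sets. Then $$\overline{\operatorname{FRec}(T)}^{\tau_X}=\overline{\operatorname{RRec}(T)}^{\tau_X}\subset\overline{\operatorname{FRec}(T^{-1})}^{\tau_X}\subset\overline{\operatorname{RRec}(T^{-1})}^{\tau_X}.$$ Moreover: (a) If $T$ is reiteratively recurrent then $T^{-1}$ is frequently recurrent. (b) If $\operatorname{RRec}(T)\neq\varnothing$ then $\operatorname{FRec}(T)\cap\operatorname{FRec}(T^{-1})\neq\varnothing$. (c) If $X$ can be endowed with a Hausdorff topology $\tau_2$ such that $T^{-1}$ is a continuous self-map of $(X,\tau_2)$, $\tau_2\subset\tau_X$, and every point of $X$ has a neighbourhood basis for $\tau_X$ consisting of $\tau_2$-compact sets, then $$\overline{\operatorname{FRec}(T)}^{\tau_X}=\overline{\operatorname{RRec}(T)}^{\tau_X}=\overline{\operatorname{FRec}(T^{-1})}^{\tau_X}=\overline{\operatorname{RRec}(T^{-1})}^{\tau_X}$$ and $T$ is reiteratively (and hence frequently) recurrent if and only if so is $T^{-1}$.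
   Context: $\mathbb{N}_0=\{0,1,2,\dots\}$. For a continuous self-map $S$ of $(X,\tau_X)$, $N_S(x,A)=\{n\in\mathbb{N}_0: S^nx\in A\}$. For $A\subset\mathbb{N}_0$: $\underline{\operatorname{dens}}(A)=\liminf_{N\to\infty}\frac{\operatorname{card}(A\cap[0,N])}{N+1}$ and $\overline{\operatorname{Bd}}(A)=\limsup_{N\to\infty}\left(\max_{m\ge0}\frac{\operatorname{card}(A\cap[m,m+N])}{N+1}\right)$. $\operatorname{FRec}(S)$ (resp. $\operatorname{RRec}(S)$) is the set of points $x$ such that $\underline{\operatorname{dens}}(N_S(x,U))>0$ (resp. $\overline{\operatorname{Bd}}(N_S(x,U))>0$) for every $\tau_X$-neighbourhood $U$ of $x$. $S$ is frequently (resp. reiteratively) recurrent if $\operatorname{FRec}(S)$ (resp. $\operatorname{RRec}(S)$) is $\tau_X$-dense in $X$. $\overline{\,\cdot\,}^{\tau_X}$ denotes $\tau_X$-closure. *)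

theory Defs
  imports "HOL-Analysis.Analysis"
begin

definition Polish_space :: "'a topology \<Rightarrow> bool"
  where "Polish_space X \<longleftrightarrow> completely_metrizable_space X \<and> separable_space X"

definition lower_dens :: "nat set \<Rightarrow> ereal"
  where "lower_dens A =
    liminf (\<lambda>N. ereal (real (card (A \<inter> {0..N})) / real (N + 1)))"

(* For fixed N the cards are bounded by N + 1, so Max ranges over a finite
   non-empty set: see finite_window_densities. *)
definition upper_Banach_dens :: "nat set \<Rightarrow> ereal"
  where "upper_Banach_dens A =
    limsup (\<lambda>N. ereal (Max (range (\<lambda>m. real (card (A \<inter> {m..m + N})) / real (N + 1)))))"

lemma finite_window_densities:
  "finite (range (\<lambda>m. real (card (A \<inter> {m..m + N})) / real (N + 1)))"
proof (rule finite_subset)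
  have "card (A \<inter> {m..m + N}) \<le> N + 1" for m
    using card_mono[of "{m..m + N}" "A \<inter> {m..m + N}"] by simp
  then show "range (\<lambda>m. real (card (A \<inter> {m..m + N})) / real (N + 1))
      \<subseteq> (\<lambda>k. real k / real (N + 1)) ` {..N + 1}"
    by (intro image_subsetI image_eqI[OF refl]) simp
qed simp

definition return_times :: "('a \<Rightarrow> 'a) \<Rightarrow> 'a \<Rightarrow> 'a set \<Rightarrow> nat set"
  where "return_times S x A = {n. (S ^^ n) x \<in> A}"

(* Neighbourhoods need not be open. *)
definition nbhd :: "'a topology \<Rightarrow> 'a \<Rightarrow> 'a set \<Rightarrow> bool"
  where "nbhd X x U \<longleftrightarrow> U \<subseteq> topspace X \<and> (\<exists>V. openin X V \<and> x \<in> V \<and> V \<subseteq> U)"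

definition FRec :: "'a topology \<Rightarrow> ('a \<Rightarrow> 'a) \<Rightarrow> 'a set"
  where "FRec X S =
    {x \<in> topspace X. \<forall>U. nbhd X x U \<longrightarrow> lower_dens (return_times S x U) > 0}"

definition RRec :: "'a topology \<Rightarrow> ('a \<Rightarrow> 'a) \<Rightarrow> 'a set"
  where "RRec X S =
    {x \<in> topspace X. \<forall>U. nbhd X x U \<longrightarrow> upper_Banach_dens (return_times S x U) > 0}"

definition frequently_recurrent :: "'a topology \<Rightarrow> ('a \<Rightarrow> 'a) \<Rightarrow> bool"
  where "frequently_recurrent X S \<longleftrightarrow> X closure_of FRec X S = topspace X"

definition reiteratively_recurrent :: "'a topology \<Rightarrow> ('a \<Rightarrow> 'a) \<Rightarrow> bool"
  where "reiteratively_recurrent X S \<longleftrightarrow> X closure_of RRec X S = topspace X"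

end

theory Submission
  imports Defs
begin

text \<open>
  Let \<open>x\<close> be reiteratively recurrent for \<open>T\<close>, and let \<open>K\<close> be a neighbourhood of \<open>x\<close> that is
  compact for the coarser topology \<open>Y\<close> on \<open>X\<close>. The heart of the matter is that there is a
  finite Borel measure on \<open>X\<close>, invariant under \<open>T\<close>, that gives positive mass to \<open>K\<close>
  (\<open>exists_invariant_measure\<close>). Such a measure is also invariant under the inverse \<open>T'\<close>, and
  almost all of its points are frequently recurrent for both maps
  (\<open>AE_frequently_recurrent_point\<close>). Hence \<open>K\<close> contains a point of
  \<open>FRec X T \<inter> FRec X T'\<close>, and since \<open>K\<close> can be taken arbitrarily small, \<open>RRec X T\<close> lies in the closure
  of that intersection (\<open>RRec_subset_closure_FRec\<close>). Everything else follows from this inclusion,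
  from its instance with the two maps exchanged, and from \<open>FRec X S \<subseteq> RRec X S\<close>.

  To find the measure, choose windows of increasing length in which the return times of \<open>x\<close>
  to \<open>K\<close> keep a positive density. A cluster point of the densities along these windows is a
  shift-invariant, finitely additive \<open>m\<close> on sets of natural numbers, positive on the return
  times to \<open>K\<close> (\<open>exists_shift_invariant_content\<close>). Then \<open>\<theta> G = m (return_times T x G)\<close> is a
  finitely additive content on \<open>X\<close>. Countable additivity is gained by covering
  with countably many \<open>Y\<close>-open sets. On \<open>Y\<close>-compact sets such a cover can be taken finite, so no
  mass of \<open>K\<close> is lost (\<open>content_le_outer_compact\<close>). All open sets of \<open>X\<close> are countable
  unions of \<open>Y\<close>-compact sets, because \<open>X\<close> is second countable; this makes \<open>Y\<close>-compact sets
  measurable (\<open>compact_caratheodory\<close>) and places the open sets of \<open>X\<close> in the sigma-algebra. The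
  preimage under \<open>T\<close> of a \<open>Y\<close>-open cover is a \<open>Y\<close>-open cover with the same contents, so
  preimages do not gain measure, and for a finite total mass this means invariance.

  The almost everywhere statement comes from cutting orbits into pieces. If a set \<open>W\<close> has
  arbitrarily sparse visits along suitable initial segments of the orbit of each of its
  points, then concatenating such segments shows that orbits visit \<open>W\<close> with
  arbitrarily small frequency, and integration gives that \<open>W\<close> is null
  (\<open>sparsely_visited_null\<close>).
\<close>

section \<open>Visiting frequencies for measure-preserving maps\<close>

definition visits :: "('a \<Rightarrow> 'a) \<Rightarrow> 'a set \<Rightarrow> nat \<Rightarrow> 'a \<Rightarrow> real"
  where "visits T W n y = (\<Sum>k<n. indicator W ((T ^^ k) y))"

lemma visits_add: "visits T W (n + m) y = visits T W n y + visits T W m ((T ^^ n) y)"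
proof (induction m)
  case (Suc m)
  have "(T ^^ (n + m)) y = (T ^^ m) ((T ^^ n) y)"
    by (metis add.commute comp_apply funpow_add)
  with Suc show ?case by (simp add: visits_def)
qed (simp add: visits_def)

lemma visits_le: "visits T W n y \<le> real n"
  unfolding visits_def by (rule order_trans[OF sum_bounded_above[where K = 1]]) (auto simp: indicator_def)

lemma visits_mono_set: "W \<subseteq> V \<Longrightarrow> visits T W n y \<le> visits T V n y"
  unfolding visits_def by (intro sum_mono) (auto simp: indicator_def)

lemma visits_eq_card: "visits T W n y = real (card (return_times T y W \<inter> {..<n}))"
proof -
  have "return_times T y W \<inter> {..<n} = {k \<in> {..<n}. (T ^^ k) y \<in> W}"
    by (auto simp: return_times_def)
  then show ?thesis
    by (simp add: visits_def indicator_def sum.If_cases Int_def)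
qed

text \<open>
  Cut the orbit segment of length \<open>l\<close> into blocks: a point of \<open>W\<close> starts a block of
  length at most \<open>m\<close> on which the frequency of visits is at most \<open>e\<close>, and a point outside
  \<open>W\<close> is a block of length one without visits. Only the last block can stick out beyond
  time \<open>l\<close>, and it costs at most \<open>m\<close>. The bound is
  uniform in the starting point.
\<close>
lemma visits_stacking:
  assumes "0 \<le> e"
    and W: "\<And>y. y \<in> W \<Longrightarrow> \<exists>n. 0 < n \<and> n \<le> m \<and> visits T W n y \<le> e * real n"
  shows "visits T W l y \<le> e * real l + real m"
proof (induction l arbitrary: y rule: less_induct)
  case (less l)
  show ?case
  proof (cases "y \<in> W")
    case True
    then obtain n where n: "0 < n" "n \<le> m" "visits T W n y \<le> e * real n"
      using W by blast
    show ?thesis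
    proof (cases "l \<le> n")
      case True
      then have "visits T W l y \<le> real m"
        using visits_le[of T W l y] n by linarith
      then show ?thesis using \<open>0 \<le> e\<close> by (simp add: add_increasing)
    next
      case False
      then have l: "l = n + (l - n)" by simp
      have "visits T W l y = visits T W n y + visits T W (l - n) ((T ^^ n) y)"
        by (subst l) (rule visits_add)
      also have "\<dots> \<le> e * real n + (e * real (l - n) + real m)"
        using n False by (intro add_mono less.IH) auto
      also have "\<dots> = e * real l + real m"
        using False by (simp add: of_nat_diff algebra_simps)
      finally show ?thesis .
    qed
  next
    case False
    show ?thesis
    proof (cases l)
      case (Suc l')
      have "visits T W l y = visits T W 1 y + visits T W l' ((T ^^ 1) y)"
        using visits_add[of T W 1 l' y] Suc by simp
      also have "\<dots> \<le> e * real l' + real m"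
        using less.IH[of l' "T y"] False Suc by (simp add: visits_def)
      also have "\<dots> \<le> e * real l + real m"
        using Suc \<open>0 \<le> e\<close> by (simp add: algebra_simps)
      finally show ?thesis .
    qed (simp add: visits_def)
  qed
qed

locale measure_preserving_map = finite_measure M for M :: "'a measure" +
  fixes T :: "'a \<Rightarrow> 'a"
  assumes measurable_T [measurable]: "T \<in> measurable M M"
    and measure_vimage: "A \<in> sets M \<Longrightarrow> measure M (T -` A \<inter> space M) = measure M A"
begin

lemma measurable_iterate [measurable]: "T ^^ k \<in> measurable M M"
  by (induction k) (auto simp: id_def intro: measurable_comp)

lemma measure_vimage_iterate:
  assumes "A \<in> sets M"
  shows "measure M ((T ^^ k) -` A \<inter> space M) = measure M A"
proof (induction k)
  case 0
  then show ?case using assms sets.sets_into_space[of A M] by (simp add: Int_absorb2)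
next
  case (Suc k)
  have "(T ^^ Suc k) -` A \<inter> space M = T -` ((T ^^ k) -` A \<inter> space M) \<inter> space M"
    using measurable_space[OF measurable_T] by (auto simp del: funpow.simps simp add: funpow_Suc_right)
  moreover have "(T ^^ k) -` A \<inter> space M \<in> sets M"
    using measurable_iterate assms by (rule measurable_sets)
  ultimately show ?case
    using Suc measure_vimage[of "(T ^^ k) -` A \<inter> space M"] by (simp only:)
qed

lemma integral_visits:
  assumes [measurable]: "W \<in> sets M"
  shows "integrable M (visits T W n)" and "integral\<^sup>L M (visits T W n) = real n * measure M W"
proof -
  have eq: "indicator W ((T ^^ k) y) = (indicator ((T ^^ k) -` W \<inter> space M) y :: real)"
    if "y \<in> space M" for k y using that by (auto simp: indicator_def)
  have int: "has_bochner_integral M (\<lambda>y. indicator W ((T ^^ k) y) :: real) (measure M W)" for k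
  proof -
    have "has_bochner_integral M (indicator ((T ^^ k) -` W \<inter> space M) :: _ \<Rightarrow> real)
        (measure M ((T ^^ k) -` W \<inter> space M))"
      by (intro has_bochner_integral_real_indicator) (auto simp: emeasure_eq_measure)
    then show ?thesis
      using measure_vimage_iterate[OF assms, of k]
      by (subst has_bochner_integral_cong[OF refl eq refl]) simp_all
  qed
  have "has_bochner_integral M (visits T W n) (\<Sum>k<n. measure M W)"
    unfolding visits_def[abs_def] by (intro has_bochner_integral_sum int)
  then show "integrable M (visits T W n)" "integral\<^sup>L M (visits T W n) = real n * measure M W"
    by (auto simp: has_bochner_integral_iff)
qed

lemma measurable_visits [measurable]: "W \<in> sets M \<Longrightarrow> visits T W n \<in> borel_measurable M"
  using integral_visits(1) by (rule borel_measurable_integrable)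

text \<open>
  Integrating the stacking bound gives \<open>l * measure M W \<le> (e * l + m) * measure M (space M)\<close>
  by invariance. Divide by \<open>l\<close> and let \<open>l\<close> grow.
\<close>
lemma measure_le_of_bounded_waiting:
  assumes W: "W \<in> sets M" and "0 \<le> e"
    and "\<And>y. y \<in> W \<Longrightarrow> \<exists>n. 0 < n \<and> n \<le> m \<and> visits T W n y \<le> e * real n"
  shows "measure M W \<le> e * measure M (space M)"
proof (rule field_le_epsilon)
  fix d :: real assume "0 < d"
  define c where "c = measure M (space M)"
  \<comment> \<open>A length for which the boundary term \<open>m * c / l\<close> drops below \<open>d\<close>.\<close>
  obtain l :: nat where l: "real m * c / d < real l" using reals_Archimedean2 by blast
  have "0 \<le> c" by (simp add: c_def)
  then have "0 \<le> real m * c / d" using \<open>0 < d\<close> by simp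
  with l have "0 < real l" by linarith
  have "real l * measure M W = integral\<^sup>L M (visits T W l)"
    using integral_visits(2)[OF W] by simp
  also have "\<dots> \<le> integral\<^sup>L M (\<lambda>_. e * real l + real m)"
    using visits_stacking[of e W m T l] assms
    by (intro integral_mono integral_visits) auto
  also have "\<dots> = (e * real l + real m) * c" by (simp add: c_def)
  also have "\<dots> \<le> real l * (e * c + d)"
    using l \<open>0 < d\<close> by (simp add: field_simps)
  finally show "measure M W \<le> e * measure M (space M) + d"
    using \<open>0 < real l\<close> by (simp add: c_def)
qed

text \<open>
  The waiting time for a sparse segment is finite at every point of \<open>W\<close> but need not be
  bounded, so \<open>W\<close> is exhausted by the sets on which it is at most \<open>m\<close>. On such a subset the
  hypothesis improves, since a subset is visited less often.
\<close>
lemma sparsely_visited_null: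
  assumes W [measurable]: "W \<in> sets M"
    and sparse: "\<And>y e. y \<in> W \<Longrightarrow> 0 < e \<Longrightarrow> \<exists>n>0. visits T W n y \<le> e * real n"
  shows "measure M W = 0"
proof -
  have le: "measure M W \<le> e * measure M (space M)" if "0 < e" for e
  proof -
    define Wm where "Wm m = {y \<in> W. \<exists>n. 0 < n \<and> n \<le> m \<and> visits T W n y \<le> e * real n}" for m
    have Wm_eq: "Wm m = {y \<in> space M. y \<in> W \<and> (\<exists>n. 0 < n \<and> n \<le> m \<and> visits T W n y \<le> e * real n)}" for m
      using sets.sets_into_space[OF W] by (auto simp: Wm_def)
    have [measurable]: "Wm m \<in> sets M" for m
      unfolding Wm_eq by measurable
    have "measure M (Wm m) \<le> e * measure M (space M)" for m
    proof (rule measure_le_of_bounded_waiting)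
      fix y assume "y \<in> Wm m"
      then obtain n where "0 < n" "n \<le> m" "visits T W n y \<le> e * real n"
        by (auto simp: Wm_def)
      moreover have "visits T (Wm m) n y \<le> visits T W n y"
        by (rule visits_mono_set) (auto simp: Wm_def)
      ultimately show "\<exists>n. 0 < n \<and> n \<le> m \<and> visits T (Wm m) n y \<le> e * real n"
        by force
    qed (use \<open>0 < e\<close> in auto)
    moreover have "(\<lambda>m. measure M (Wm m)) \<longlonglongrightarrow> measure M (\<Union>m. Wm m)"
    proof (rule finite_Lim_measure_incseq)
      show "incseq Wm" by (force simp: Wm_def incseq_def)
    qed auto
    moreover have "(\<Union>m. Wm m) = W"
      using sparse[OF _ \<open>0 < e\<close>] by (auto simp: Wm_def)
    ultimately show ?thesis by (metis LIMSEQ_le_const2)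
  qed
  have "measure M W \<le> 0 + d" if "0 < d" for d
  proof -
    have "measure M W \<le> d / (measure M (space M) + 1) * measure M (space M)"
      using that by (intro le divide_pos_pos) (auto simp: add_nonneg_pos)
    also have "\<dots> \<le> d"
      using that measure_nonneg[of M "space M"]
      by (simp add: divide_simps not_less add_nonneg_nonneg)
    finally show ?thesis by simp
  qed
  then have "measure M W \<le> 0" by (rule field_le_epsilon)
  then show ?thesis by (simp add: measure_le_0_iff)
qed

lemma lower_dens_pos_of_visits:
  assumes "0 < e" and "\<And>n. 0 < n \<Longrightarrow> e * real n \<le> visits T V n y"
  shows "lower_dens (return_times T y V) > 0"
proof -
  have "ereal e \<le> lower_dens (return_times T y V)"
    unfolding lower_dens_def
  proof (intro Liminf_bounded always_eventually allI)
    fix N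
    have "{0..N} = {..<Suc N}" by auto
    then show "ereal e \<le> ereal (real (card (return_times T y V \<inter> {0..N})) / real (N + 1))"
      using assms(2)[of "Suc N"] by (simp add: visits_eq_card field_simps)
  qed
  then show ?thesis using \<open>0 < e\<close> by (metis ereal_less(2) less_le_trans)
qed

text \<open>
  A weak form of the pointwise ergodic theorem: instead of a limit of the visiting frequencies
  it gives a positive lower bound for them. The
  exceptional points of \<open>V\<close> all lie in the set \<open>W\<close> of those points that have arbitrarily
  sparse initial orbit segments. As \<open>W\<close> lies in \<open>V\<close>, it is even more sparsely visited
  along these segments, so it is null.
\<close>
theorem AE_lower_dens_return_times_pos:
  assumes [measurable]: "V \<in> sets M"
  shows "AE y in M. y \<in> V \<longrightarrow> lower_dens (return_times T y V) > 0"
proof (rule AE_I')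
  define W where "W = {y \<in> space M. y \<in> V \<and> (\<forall>j. \<exists>n>0. visits T V n y \<le> real n / real (Suc j))}"
  have [measurable]: "W \<in> sets M" unfolding W_def by measurable
  have "measure M W = 0"
  proof (rule sparsely_visited_null)
    fix y and e :: real assume "y \<in> W" "0 < e"
    obtain j where j: "inverse (real (Suc j)) < e" using reals_Archimedean \<open>0 < e\<close> by blast
    from \<open>y \<in> W\<close> obtain n where n: "n > 0" "visits T V n y \<le> real n / real (Suc j)"
      by (auto simp: W_def)
    have "visits T W n y \<le> visits T V n y" by (rule visits_mono_set) (auto simp: W_def)
    also have "\<dots> \<le> inverse (real (Suc j)) * real n" using n by (simp add: field_simps)
    also have "\<dots> \<le> e * real n" using j by (intro mult_right_mono) auto
    finally show "\<exists>n>0. visits T W n y \<le> e * real n" using n by blast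
  qed simp
  then show "W \<in> null_sets M" by (simp add: null_sets_def emeasure_eq_measure)
  show "{y \<in> space M. \<not> (y \<in> V \<longrightarrow> lower_dens (return_times T y V) > 0)} \<subseteq> W"
  proof (rule subsetI, rule ccontr)
    fix y assume y: "y \<in> {y \<in> space M. \<not> (y \<in> V \<longrightarrow> lower_dens (return_times T y V) > 0)}" "y \<notin> W"
    then have "\<not> (\<forall>j. \<exists>n>0. visits T V n y \<le> real n / real (Suc j))"
      unfolding W_def by blast
    then obtain j where j: "\<And>n. 0 < n \<Longrightarrow> real n / real (Suc j) < visits T V n y"
      by (meson not_le)
    have "lower_dens (return_times T y V) > 0"
    proof (rule lower_dens_pos_of_visits)
      show "1 / real (Suc j) * real n \<le> visits T V n y" if "0 < n" for n
        using j[OF that] by simp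
    qed simp
    with y show False by simp
  qed
qed

end

lemma lower_dens_mono:
  assumes "A \<subseteq> B"
  shows "lower_dens A \<le> lower_dens B"
  unfolding lower_dens_def
proof (intro Liminf_mono always_eventually allI)
  fix N
  have "card (A \<inter> {0..N}) \<le> card (B \<inter> {0..N})"
    using assms by (intro card_mono) auto
  then show "ereal (real (card (A \<inter> {0..N})) / real (N + 1))
      \<le> ereal (real (card (B \<inter> {0..N})) / real (N + 1))"
    by (simp add: divide_right_mono)
qed

text \<open>
  Frequent recurrence only has to be tested on a countable base, and countably many null
  sets may be discarded.
\<close>
theorem AE_frequently_recurrent_point:
  assumes X: "second_countable X" and "measure_preserving_map M T"
    and sp: "space M = topspace X" and op: "\<And>U. openin X U \<Longrightarrow> U \<in> sets M"
  shows "AE y in M. y \<in> FRec X T"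
proof -
  interpret measure_preserving_map M T by fact
  obtain \<B> where \<B>: "countable \<B>" "\<And>V. V \<in> \<B> \<Longrightarrow> openin X V"
      and base: "\<And>U y. openin X U \<Longrightarrow> y \<in> U \<Longrightarrow> \<exists>V\<in>\<B>. y \<in> V \<and> V \<subseteq> U"
    using X unfolding second_countable_def by metis
  have "AE y in M. \<forall>V\<in>\<B>. y \<in> V \<longrightarrow> lower_dens (return_times T y V) > 0"
    using \<B> op by (intro AE_ball_countable' AE_lower_dens_return_times_pos) auto
  then show ?thesis
    using AE_space
  proof eventually_elim
    case (elim y)
    then have y: "y \<in> topspace X"
      and pos: "\<forall>V\<in>\<B>. y \<in> V \<longrightarrow> lower_dens (return_times T y V) > 0"
      using sp by auto
    show "y \<in> FRec X T" unfolding FRec_def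
    proof (intro CollectI conjI allI impI)
      fix U assume "nbhd X y U"
      then obtain O' where "openin X O'" "y \<in> O'" "O' \<subseteq> U"
        unfolding nbhd_def by blast
      with base[of O' y] obtain V where V: "V \<in> \<B>" "y \<in> V" "V \<subseteq> U" by blast
      then have "lower_dens (return_times T y V) \<le> lower_dens (return_times T y U)"
        by (intro lower_dens_mono) (auto simp: return_times_def)
      with pos V(1,2) show "lower_dens (return_times T y U) > 0"
        by (meson less_le_trans)
    qed (rule y)
  qed
qed
lemma measure_preserving_inverse:
  assumes "measure_preserving_map M T" and T': "T' \<in> measurable M M"
    and inv: "\<And>y. y \<in> space M \<Longrightarrow> T' (T y) = y"
  shows "measure_preserving_map M T'"
proof -
  interpret measure_preserving_map M T by fact
  show ?thesis
  proof
    fix A assume A: "A \<in> sets M"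
    have "T -` (T' -` A \<inter> space M) \<inter> space M = A"
      using sets.sets_into_space[OF A] inv measurable_space[OF measurable_T] by auto
    then show "measure M (T' -` A \<inter> space M) = measure M A"
      using measure_vimage[OF measurable_sets[OF T' A]] by simp
  qed (rule T')
qed

section \<open>Measures from contents on Hausdorff spaces\<close>

text \<open>
  The covers consist of open sets because these can be thinned out to finite covers on compact
  sets, where finite additivity of \<open>\<theta>\<close> is enough to control them.
\<close>
definition cover_outer :: "'a topology \<Rightarrow> ('a set \<Rightarrow> real) \<Rightarrow> 'a set \<Rightarrow> ennreal"
  where "cover_outer Y \<theta> E =
    (INF G\<in>{G :: nat \<Rightarrow> 'a set. (\<forall>i. openin Y (G i)) \<and> E \<subseteq> (\<Union>i. G i)}. \<Sum>i. ennreal (\<theta> (G i)))"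

text \<open>
  Additivity is asked for all sets, as it holds for the contents \<open>\<lambda>A. m {n. f n \<in> A}\<close> that a
  sequence \<open>f\<close> and a finitely additive \<open>m\<close> induce. Regularity is produced by \<open>cover_outer\<close>.
\<close>
locale Hausdorff_content =
  fixes Y :: "'a topology" and \<theta> :: "'a set \<Rightarrow> real"
  assumes Hausdorff: "Hausdorff_space Y"
    and nonneg: "0 \<le> \<theta> A"
    and additive: "disjnt A B \<Longrightarrow> \<theta> (A \<union> B) = \<theta> A + \<theta> B"
begin

abbreviation outer :: "'a set \<Rightarrow> ennreal"
  where "outer \<equiv> cover_outer Y \<theta>"

lemma content_empty: "\<theta> {} = 0"
  using additive[of "{}" "{}"] by simp

lemma content_mono: "A \<subseteq> B \<Longrightarrow> \<theta> A \<le> \<theta> B"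
  using additive[of A "B - A"] nonneg[of "B - A"] by (simp add: disjnt_def Un_absorb1)

lemma content_subadditive: "\<theta> (A \<union> B) \<le> \<theta> A + \<theta> B"
  using additive[of A "B - A"] content_mono[of "B - A" B] by (simp add: disjnt_def)

lemma content_UN_le: "finite I \<Longrightarrow> \<theta> (\<Union>i\<in>I. G i) \<le> (\<Sum>i\<in>I. \<theta> (G i))"
proof (induction I rule: finite_induct)
  case (insert i I)
  then show ?case using content_subadditive[of "G i" "\<Union>i\<in>I. G i"] by simp
qed (simp add: content_empty)

lemma outer_le_cover:
  assumes "\<And>i. openin Y (G i)" "E \<subseteq> (\<Union>i. G i)"
  shows "outer E \<le> (\<Sum>i::nat. ennreal (\<theta> (G i)))"
  unfolding cover_outer_def using assms by (intro INF_lower) auto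

lemma outer_cover_approx:
  assumes "outer E < top" "0 < e"
  obtains G where "\<And>i. openin Y (G i)" "E \<subseteq> (\<Union>i. G i)"
    "(\<Sum>i::nat. ennreal (\<theta> (G i))) < outer E + ennreal e"
proof -
  have "outer E < outer E + ennreal e"
    using assms by (cases "outer E" rule: ennreal_cases) (auto simp flip: ennreal_plus simp: ennreal_less_iff)
  then show ?thesis
    using that unfolding cover_outer_def INF_less_iff by auto
qed

lemma outer_mono: "E \<subseteq> F \<Longrightarrow> outer E \<le> outer F"
  unfolding cover_outer_def by (rule INF_superset_mono) auto

lemma outer_open_le:
  assumes "openin Y G"
  shows "outer G \<le> ennreal (\<theta> G)"
proof -
  have "outer G \<le> (\<Sum>i. ennreal (\<theta> (if i = (0::nat) then G else {})))"
    using assms by (intro outer_le_cover) (auto split: if_splits)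
  also have "\<dots> = (\<Sum>i\<in>{0::nat}. ennreal (\<theta> (if i = 0 then G else {})))"
    by (intro suminf_finite) (auto simp: content_empty)
  finally show ?thesis by simp
qed

lemma outer_empty: "outer {} = 0"
  using outer_open_le[of "{}"] by (simp add: content_empty)

lemma outer_less_top: "E \<subseteq> topspace Y \<Longrightarrow> outer E < top"
  using outer_mono[of E "topspace Y"] outer_open_le[of "topspace Y"]
  by (meson ennreal_less_top le_less_trans openin_topspace)

lemma outer_UN_le: "outer (\<Union>n. E n) \<le> (\<Sum>n::nat. outer (E n))"
proof (rule ennreal_le_epsilon)
  fix e :: real assume fin: "(\<Sum>n. outer (E n)) < top" and "0 < e"
  have "\<exists>G. (\<forall>i. openin Y (G i)) \<and> E n \<subseteq> (\<Union>i. G i) \<and>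
      (\<Sum>i::nat. ennreal (\<theta> (G i))) < outer (E n) + ennreal (e * (1/2) ^ Suc n)" for n
  proof -
    have "outer (E n) < top" "0 < e * (1/2) ^ Suc n"
      using ennreal_suminf_lessD[OF fin, of n] \<open>0 < e\<close> by auto
    then show ?thesis by (rule outer_cover_approx) blast
  qed
  then have "\<exists>G. \<forall>n. (\<forall>i. openin Y (G n i)) \<and> E n \<subseteq> (\<Union>i. G n i) \<and>
      (\<Sum>i::nat. ennreal (\<theta> (G n i))) < outer (E n) + ennreal (e * (1/2) ^ Suc n)"
    by (intro choice allI)
  then obtain G where G: "\<And>n i. openin Y (G n i)" "\<And>n. E n \<subseteq> (\<Union>i. G n i)"
      "\<And>n. (\<Sum>i::nat. ennreal (\<theta> (G n i))) < outer (E n) + ennreal (e * (1/2) ^ Suc n)"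
    by blast
  have "outer (\<Union>n. E n) \<le> (\<Sum>k. ennreal (\<theta> (case_prod G (prod_decode k))))"
  proof (rule outer_le_cover)
    show "openin Y (case_prod G (prod_decode k))" for k
      using G(1) by (simp split: prod.split)
    show "(\<Union>n. E n) \<subseteq> (\<Union>k. case_prod G (prod_decode k))"
    proof clarify
      fix x n assume "x \<in> E n"
      then obtain i where "x \<in> G n i" using G(2) by blast
      then have "x \<in> case_prod G (prod_decode (prod_encode (n, i)))"
        by (simp only: prod_encode_inverse case_prod_conv)
      then show "x \<in> (\<Union>k. case_prod G (prod_decode k))" by (rule UN_I[OF UNIV_I])
    qed
  qed
  also have "\<dots> = (\<Sum>n. \<Sum>i. ennreal (\<theta> (G n i)))"
    using suminf_ennreal_2dimen[of "\<lambda>n. \<Sum>i. ennreal (\<theta> (G n i))" "\<lambda>p. ennreal (\<theta> (case_prod G p))"]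
    by simp
  also have "\<dots> \<le> (\<Sum>n. outer (E n) + ennreal (e * (1/2) ^ Suc n))"
    using G(3) by (intro suminf_le) (auto intro: less_imp_le)
  also have "\<dots> = (\<Sum>n. outer (E n)) + (\<Sum>n. ennreal (e * (1/2) ^ Suc n))"
    by (intro suminf_add[symmetric]) auto
  also have "(\<Sum>n. ennreal (e * (1/2) ^ Suc n)) = ennreal e"
    using \<open>0 < e\<close> sums_mult[OF power_half_series, of e] by (intro suminf_ennreal_eq) auto
  finally show "outer (\<Union>n. E n) \<le> (\<Sum>n. outer (E n)) + ennreal e" .
qed

lemma outer_Un_le: "outer (E \<union> F) \<le> outer E + outer F"
proof -
  have "outer (E \<union> F) = outer (\<Union>n. binaryset E F n)"
    by (simp only: UN_binaryset_eq)
  also have "\<dots> \<le> (\<Sum>n. outer (binaryset E F n))"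
    by (rule outer_UN_le)
  also have "\<dots> = outer E + outer F"
    by (rule suminf_binaryset_eq) (rule outer_empty)
  finally show ?thesis .
qed

text \<open>
  By compactness finitely many members of a nearly optimal cover suffice, and finite
  subadditivity of \<open>\<theta>\<close> allows replacing them by their union.
\<close>
lemma outer_compact_approx:
  assumes K: "compactin Y K" and "0 < e"
  obtains G where "openin Y G" "K \<subseteq> G" "ennreal (\<theta> G) < outer K + ennreal e"
proof -
  obtain W where W: "\<And>i. openin Y (W i)" "K \<subseteq> (\<Union>i. W i)"
      "(\<Sum>i::nat. ennreal (\<theta> (W i))) < outer K + ennreal e"
    using outer_cover_approx[OF outer_less_top[OF compactin_subset_topspace[OF K]] \<open>0 < e\<close>] by blast
  obtain \<F> where "finite \<F>" "\<F> \<subseteq> range W" "K \<subseteq> \<Union>\<F>"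
    using K W(1,2) unfolding compactin_def by (metis imageE)
  then obtain I where I: "finite I" "K \<subseteq> (\<Union>i\<in>I. W i)"
    by (metis finite_subset_image)
  have "ennreal (\<theta> (\<Union>i\<in>I. W i)) \<le> (\<Sum>i\<in>I. ennreal (\<theta> (W i)))"
    using content_UN_le[OF I(1)] by (simp add: nonneg ennreal_leI)
  also have "\<dots> \<le> (\<Sum>i. ennreal (\<theta> (W i)))"
    using I(1) by (intro sum_le_suminf) auto
  also note W(3)
  finally have less: "ennreal (\<theta> (\<Union>i\<in>I. W i)) < outer K + ennreal e" .
  have "openin Y (\<Union>i\<in>I. W i)"
    by (intro openin_Union) (auto simp: W(1))
  then show ?thesis
    using I(2) less by (rule that)
qed

text \<open>
  Compact sets lose no mass when \<open>\<theta>\<close> is replaced by the outer measure. This is what makes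
  the final measure nonzero.
\<close>
lemma content_le_outer_compact:
  assumes "compactin Y K"
  shows "ennreal (\<theta> K) \<le> outer K"
proof (rule ennreal_le_epsilon)
  fix e :: real assume "0 < e"
  with assms obtain G where "K \<subseteq> G" and G: "ennreal (\<theta> G) < outer K + ennreal e"
    by (rule outer_compact_approx)
  have "ennreal (\<theta> K) \<le> ennreal (\<theta> G)"
    using \<open>K \<subseteq> G\<close> by (intro ennreal_leI content_mono)
  with G show "ennreal (\<theta> K) \<le> outer K + ennreal e" by simp
qed

text \<open>
  Disjoint compact sets have disjoint open neighbourhoods, on which \<open>\<theta>\<close> is additive.
\<close>
lemma outer_separated_le:
  assumes "compactin Y C" "compactin Y D" "disjnt C D" "openin Y G" "C \<subseteq> G"
  shows "outer C + outer (G \<inter> D) \<le> ennreal (\<theta> G)"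
proof -
  obtain U V where UV: "openin Y U" "openin Y V" "C \<subseteq> U" "D \<subseteq> V" "disjnt U V"
    using Hausdorff_space_compact_separation[OF Hausdorff assms(1,2,3)] by blast
  have "outer C + outer (G \<inter> D) \<le> ennreal (\<theta> (G \<inter> U)) + ennreal (\<theta> (G \<inter> V))"
    using UV assms by (intro add_mono order_trans[OF outer_mono outer_open_le]) auto
  also have "\<dots> = ennreal (\<theta> ((G \<inter> U) \<union> (G \<inter> V)))"
    using UV additive[of "G \<inter> U" "G \<inter> V"] by (simp add: nonneg disjnt_def ennreal_plus inf_commute Int_left_commute Int_assoc)
  also have "\<dots> \<le> ennreal (\<theta> G)" by (intro ennreal_leI content_mono) auto
  finally show ?thesis .
qed

lemma outer_disjoint_compact_le:
  assumes "compactin Y C" "compactin Y D" "disjnt C D"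
  shows "outer C + outer D \<le> outer (C \<union> D)"
proof (rule ennreal_le_epsilon)
  fix e :: real assume "0 < e"
  have "compactin Y (C \<union> D)" using assms by (intro compactin_Un)
  then obtain G where G: "openin Y G" "C \<union> D \<subseteq> G" "ennreal (\<theta> G) < outer (C \<union> D) + ennreal e"
    using outer_compact_approx \<open>0 < e\<close> by blast
  then have "outer C + outer (G \<inter> D) \<le> ennreal (\<theta> G)"
    using assms by (intro outer_separated_le) auto
  moreover have "G \<inter> D = D" using G by auto
  ultimately show "outer C + outer D \<le> outer (C \<union> D) + ennreal e"
    using G(3) by (metis less_imp_le order_trans)
qed

text \<open>
  Continuity from below along increasing compact sets. Open sets \<open>G 0, G 1, ...\<close> are chosen one
  after the other, \<open>G (Suc n)\<close> being a nearly optimal neighbourhood of what the earlier ones leave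
  uncovered of \<open>K (Suc n)\<close>. That remainder is compact and disjoint from \<open>K n\<close>, so its outer measure
  is at most the increment from \<open>K n\<close> to \<open>K (Suc n)\<close>, and the sum over the cover telescopes.
\<close>
lemma outer_UN_compact_le:
  assumes K: "\<And>n. compactin Y (K n)" and "incseq K" and le: "\<And>n. outer (K n) \<le> c"
  shows "outer (\<Union>n. K n) \<le> c"
proof (rule ennreal_le_epsilon)
  fix e :: real assume "0 < e"
  define d where "d n = e * (1/2) ^ Suc n" for n
  have d: "0 < d n" for n using \<open>0 < e\<close> by (simp add: d_def)
  \<comment> \<open>A state is a pair: the open set chosen last, and the union of all those chosen so far.\<close>
  define P where "P n p \<longleftrightarrow> openin Y (fst p) \<and> openin Y (snd p) \<and> K n \<subseteq> snd p
      \<and> (n = 0 \<longrightarrow> snd p = fst p \<and> ennreal (\<theta> (fst p)) \<le> outer (K 0) + ennreal (d 0))"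
    for n and p :: "'a set \<times> 'a set"
  define Q where "Q n p q \<longleftrightarrow> snd q = snd p \<union> fst q
      \<and> outer (K n) + ennreal (\<theta> (fst q)) \<le> outer (K (Suc n)) + ennreal (d (Suc n))"
    for n and p q :: "'a set \<times> 'a set"
  have "\<exists>f. \<forall>n. P n (f n) \<and> Q n (f n) (f (Suc n))"
  proof (rule dependent_nat_choice)
    obtain G where "openin Y G" "K 0 \<subseteq> G" "ennreal (\<theta> G) < outer (K 0) + ennreal (d 0)"
      using outer_compact_approx[OF K d] by blast
    then show "\<exists>p. P 0 p"
      by (intro exI[of _ "(G, G)"]) (simp add: P_def less_imp_le)
  next
    fix p n
    assume p: "P n p"
    define C where "C = K (Suc n) \<inter> (topspace Y - snd p)"
    have C: "compactin Y C"
      unfolding C_def using p by (intro compact_Int_closedin K) (auto simp: P_def)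
    have Ksub: "K n \<subseteq> K (Suc n)" using \<open>incseq K\<close> by (simp add: incseq_SucD)
    obtain G where G: "openin Y G" "C \<subseteq> G" "ennreal (\<theta> G) < outer C + ennreal (d (Suc n))"
      using outer_compact_approx[OF C d] by blast
    have "outer (K n) + ennreal (\<theta> G) \<le> (outer (K n) + outer C) + ennreal (d (Suc n))"
      using G(3) by (simp add: add.assoc add_left_mono less_imp_le)
    also have "outer (K n) + outer C \<le> outer (K n \<union> C)"
      using p by (intro outer_disjoint_compact_le K C) (auto simp: P_def disjnt_def C_def)
    also have "outer (K n \<union> C) \<le> outer (K (Suc n))"
      using Ksub by (intro outer_mono) (auto simp: C_def)
    finally have "outer (K n) + ennreal (\<theta> G) \<le> outer (K (Suc n)) + ennreal (d (Suc n))"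
      by (simp add: add_right_mono)
    moreover have "K (Suc n) \<subseteq> snd p \<union> G"
      using G(2) compactin_subset_topspace[OF K, of "Suc n"] by (auto simp: C_def)
    ultimately have "P (Suc n) (G, snd p \<union> G)" "Q n p (G, snd p \<union> G)"
      using p G(1) by (auto simp: P_def Q_def)
    then show "\<exists>q. P (Suc n) q \<and> Q n p q" by blast
  qed
  then obtain f where PQ: "P n (f n)" "Q n (f n) (f (Suc n))" for n by blast
  have f: "openin Y (fst (f n))" "K n \<subseteq> snd (f n)"
      "snd (f (Suc n)) = snd (f n) \<union> fst (f (Suc n))"
      "outer (K n) + ennreal (\<theta> (fst (f (Suc n)))) \<le> outer (K (Suc n)) + ennreal (d (Suc n))" for n
    using PQ[of n] by (simp_all add: P_def Q_def)
  have f0: "snd (f 0) = fst (f 0)" "ennreal (\<theta> (fst (f 0))) \<le> outer (K 0) + ennreal (d 0)"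
    using PQ(1)[of 0] by (simp_all add: P_def)
  define G where "G n = fst (f n)" for n
  have snd_f: "snd (f n) = (\<Union>i\<le>n. G i)" for n
  proof (induction n)
    case 0
    show ?case by (simp add: f0(1) G_def)
  next
    case (Suc n)
    have "snd (f (Suc n)) = (\<Union>i\<le>n. G i) \<union> G (Suc n)"
      unfolding f(3) Suc G_def ..
    then show ?case by (simp add: atMost_Suc Un_commute)
  qed
  have cover: "(\<Union>n. K n) \<subseteq> (\<Union>n. G n)"
  proof (rule UN_least)
    fix n
    have "K n \<subseteq> (\<Union>i\<le>n. G i)" using f(2)[of n] by (simp only: snd_f)
    then show "K n \<subseteq> (\<Union>n. G n)" by (rule order_trans) (intro UN_mono; simp)
  qed
  have sum_le: "(\<Sum>i\<le>n. ennreal (\<theta> (G i))) \<le> outer (K n) + (\<Sum>i\<le>n. ennreal (d i))" for n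
  proof (induction n)
    case 0
    show ?case using f0(2) by (simp add: G_def)
  next
    case (Suc n)
    have "(\<Sum>i\<le>Suc n. ennreal (\<theta> (G i)))
        \<le> (outer (K n) + ennreal (\<theta> (G (Suc n)))) + (\<Sum>i\<le>n. ennreal (d i))"
      using add_right_mono[OF Suc, of "ennreal (\<theta> (G (Suc n)))"]
      by (simp only: sum.atMost_Suc ac_simps)
    also have "\<dots> \<le> (outer (K (Suc n)) + ennreal (d (Suc n))) + (\<Sum>i\<le>n. ennreal (d i))"
      using f(4)[of n] by (intro add_right_mono) (simp add: G_def)
    finally show ?case by (simp only: sum.atMost_Suc ac_simps)
  qed
  have d_sums: "d sums e"
    using sums_mult[OF power_half_series, of e] by (simp add: d_def[abs_def])
  have d_sum: "(\<Sum>i\<le>n. ennreal (d i)) \<le> ennreal e" for n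
  proof -
    have "(\<Sum>i\<le>n. ennreal (d i)) \<le> (\<Sum>i. ennreal (d i))" by (intro sum_le_suminf) auto
    also have "\<dots> = ennreal e" using d d_sums by (intro suminf_ennreal_eq) (auto intro: less_imp_le)
    finally show ?thesis .
  qed
  have "outer (\<Union>n. K n) \<le> (\<Sum>n. ennreal (\<theta> (G n)))"
    using cover f(1) by (intro outer_le_cover) (auto simp: G_def)
  also have "\<dots> \<le> c + ennreal e"
  proof (rule suminf_le_const[OF summableI])
    fix n
    have "(\<Sum>i<n. ennreal (\<theta> (G i))) \<le> (\<Sum>i\<le>n. ennreal (\<theta> (G i)))"
      by (intro sum_mono2) auto
    also have "\<dots> \<le> outer (K n) + (\<Sum>i\<le>n. ennreal (d i))" by (rule sum_le)
    also have "\<dots> \<le> c + ennreal e" by (intro add_mono le d_sum)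
    finally show "(\<Sum>i<n. ennreal (\<theta> (G i))) \<le> c + ennreal e" .
  qed
  finally show "outer (\<Union>n. K n) \<le> c + ennreal e" .
qed

end

text \<open>
  If all open sets are countable unions of compact sets, then inner approximation by compact
  sets is available on open sets, and this yields measurability in the sense of Caratheodory.
\<close>
locale sigma_compact_content = Hausdorff_content +
  assumes sigma_compact: "openin Y G \<Longrightarrow> \<exists>K. (\<forall>n. compactin Y (K n)) \<and> incseq K \<and> (\<Union>n::nat. K n) = G"
begin

text \<open>
  For compact \<open>C\<close> inside \<open>G - F\<close> the inequality with \<open>C\<close> in place of \<open>G - F\<close> is the
  separation of disjoint compact sets. Let \<open>C\<close> increase to \<open>G - F\<close>.
\<close>
lemma outer_compact_split_open:
  assumes F: "compactin Y F" and G: "openin Y G"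
  shows "outer (G \<inter> F) + outer (G - F) \<le> ennreal (\<theta> G)"
proof -
  have "openin Y (G - F)"
    using G compactin_imp_closedin[OF Hausdorff F] by (rule openin_diff)
  then obtain K where K: "\<And>n. compactin Y (K n)" "incseq K" "(\<Union>n::nat. K n) = G - F"
    using sigma_compact[of "G - F"] by blast
  have le: "outer (G \<inter> F) + outer (K n) \<le> ennreal (\<theta> G)" for n
    using outer_separated_le[of "K n" F G] K F G by (auto simp: disjnt_def add.commute)
  have fin: "outer (G \<inter> F) < top"
    using openin_subset[OF G] by (intro outer_less_top) auto
  have "outer (G - F) \<le> ennreal (\<theta> G) - outer (G \<inter> F)"
    unfolding K(3)[symmetric] using le fin
    by (intro outer_UN_compact_le K) (simp add: ennreal_le_minus_iff add.commute)
  then have "outer (G \<inter> F) + outer (G - F) \<le> outer (G \<inter> F) + (ennreal (\<theta> G) - outer (G \<inter> F))"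
    by (rule add_left_mono)
  also have "\<dots> = ennreal (\<theta> G)"
    by (rule add_diff_inverse_ennreal, rule order_trans[OF _ le[of 0]]) simp
  finally show ?thesis .
qed

lemma outer_compact_split:
  assumes F: "compactin Y F"
  shows "outer (E \<inter> F) + outer (E - F) \<le> outer E"
  unfolding cover_outer_def[of Y \<theta> E]
proof (rule INF_greatest, clarify)
  fix G :: "nat \<Rightarrow> 'a set" assume G: "\<forall>i. openin Y (G i)" "E \<subseteq> (\<Union>i. G i)"
  have "outer (E \<inter> F) + outer (E - F) \<le> outer (\<Union>i. G i \<inter> F) + outer (\<Union>i. G i - F)"
    using G(2) by (intro add_mono outer_mono) auto
  also have "\<dots> \<le> (\<Sum>i. outer (G i \<inter> F)) + (\<Sum>i. outer (G i - F))"
    by (intro add_mono outer_UN_le)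
  also have "\<dots> = (\<Sum>i. outer (G i \<inter> F) + outer (G i - F))"
    by (intro suminf_add) auto
  also have "\<dots> \<le> (\<Sum>i. ennreal (\<theta> (G i)))"
    using G(1) by (intro suminf_le outer_compact_split_open F) auto
  finally show "outer (E \<inter> F) + outer (E - F) \<le> (\<Sum>i. ennreal (\<theta> (G i)))" .
qed

lemma outer_measure_space_outer: "outer_measure_space (Pow (topspace Y)) outer"
  unfolding outer_measure_space_def positive_def increasing_def countably_subadditive_def
  by (intro conjI allI ballI impI outer_empty outer_mono outer_UN_le)

lemma compact_caratheodory:
  assumes F: "compactin Y F"
  shows "F \<in> lambda_system (topspace Y) (Pow (topspace Y)) outer"
proof -
  interpret sigma_algebra "topspace Y" "Pow (topspace Y)" by (rule sigma_algebra_Pow)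
  have "outer (E \<inter> F) + outer (E - F) = outer E" for E
  proof (rule antisym[OF outer_compact_split[OF F]])
    show "outer E \<le> outer (E \<inter> F) + outer (E - F)"
      using outer_Un_le[of "E \<inter> F" "E - F"] by (simp add: Int_Diff_Un)
  qed
  then show ?thesis
    using compactin_subset_topspace[OF F] by (auto simp: lambda_system_eq)
qed

text \<open>
  The generated sigma-algebra contains the open sets of every finer topology whose open sets
  are still countable unions of sets that are compact for \<open>Y\<close>.
\<close>
definition "content_measure = measure_of (topspace Y) (Collect (compactin Y)) outer"

lemma space_content_measure: "space content_measure = topspace Y"
  and sets_content_measure:
    "sets content_measure = sigma_sets (topspace Y) (Collect (compactin Y))"
  and emeasure_content_measure:
    "A \<in> sets content_measure \<Longrightarrow> emeasure content_measure A = outer A"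
proof -
  have sub: "Collect (compactin Y) \<subseteq> Pow (topspace Y)"
    using compactin_subset_topspace by auto
  show "space content_measure = topspace Y"
    and sets: "sets content_measure = sigma_sets (topspace Y) (Collect (compactin Y))"
    unfolding content_measure_def using sub by simp_all
  define L where "L = lambda_system (topspace Y) (Pow (topspace Y)) outer"
  have L: "measure_space (topspace Y) L outer"
    unfolding L_def
    by (rule sigma_algebra.caratheodory_lemma[OF sigma_algebra_Pow outer_measure_space_outer])
  then interpret L: sigma_algebra "topspace Y" L by (simp add: measure_space_def)
  have "sets content_measure \<subseteq> L"
    unfolding sets using compact_caratheodory by (intro L.sigma_sets_subset) (auto simp: L_def)
  then have "positive (sets content_measure) outer" "countably_additive (sets content_measure) outer"
    using L by (auto simp: measure_space_def positive_def countably_additive_def)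
  then show "emeasure content_measure A = outer A" if "A \<in> sets content_measure"
    using that by (rule emeasure_measure_of[OF content_measure_def sub])
qed

lemma finite_content_measure: "finite_measure content_measure"
proof (rule finite_measureI)
  have "outer (topspace Y) \<noteq> top" using outer_less_top[of "topspace Y"] by simp
  then show "emeasure content_measure (space content_measure) \<noteq> \<infinity>"
    using emeasure_content_measure[of "topspace Y"] sets.top[of content_measure]
    by (simp add: space_content_measure)
qed

lemma openin_sets_content_measure:
  assumes "openin Y G" shows "G \<in> sets content_measure"
proof -
  obtain K where K: "\<And>n. compactin Y (K n)" "(\<Union>n::nat. K n) = G"
    using sigma_compact[OF assms] by blast
  have "(\<Union>n. K n) \<in> sets content_measure"
  proof (intro sets.countable_UN image_subsetI)
    show "K n \<in> sets content_measure" for n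
      unfolding sets_content_measure by (rule sigma_sets.Basic) (simp add: K(1))
  qed
  with K(2) show ?thesis by simp
qed

end

section \<open>Invariance of the measure of a content\<close>

context sigma_compact_content
begin

text \<open>
  Preimages of open covers are open covers of the same total content. The reverse
  inequality is not visible at this level, as not every cover of a preimage arises in this way.
\<close>
lemma outer_vimage_le:
  assumes T: "continuous_map Y Y T"
    and inv: "\<And>G. openin Y G \<Longrightarrow> \<theta> {y \<in> topspace Y. T y \<in> G} = \<theta> G"
  shows "outer {y \<in> topspace Y. T y \<in> E} \<le> outer E"
  unfolding cover_outer_def[of Y \<theta> E]
proof (rule INF_greatest)
  fix G :: "nat \<Rightarrow> 'a set"
  assume "G \<in> {G. (\<forall>i. openin Y (G i)) \<and> E \<subseteq> (\<Union>i. G i)}"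
  then have G: "\<And>i. openin Y (G i)" "E \<subseteq> (\<Union>i. G i)" by auto
  have "outer {y \<in> topspace Y. T y \<in> E} \<le> (\<Sum>i. ennreal (\<theta> {y \<in> topspace Y. T y \<in> G i}))"
  proof (rule outer_le_cover)
    show "openin Y {y \<in> topspace Y. T y \<in> G i}" for i
      using T G(1) by (rule openin_continuous_map_preimage)
  qed (use G(2) in auto)
  also have "\<dots> = (\<Sum>i. ennreal (\<theta> (G i)))"
    by (simp only: inv[OF G(1)])
  finally show "outer {y \<in> topspace Y. T y \<in> E} \<le> (\<Sum>i. ennreal (\<theta> (G i)))" .
qed

lemma measurable_content_measure:
  assumes "T \<in> topspace Y \<rightarrow> topspace Y"
    and "\<And>K. compactin Y K \<Longrightarrow> {y \<in> topspace Y. T y \<in> K} \<in> sets content_measure"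
  shows "T \<in> measurable content_measure content_measure"
proof (rule measurable_sigma_sets[OF sets_content_measure])
  show "T -` A \<inter> space content_measure \<in> sets content_measure" if "A \<in> Collect (compactin Y)" for A
  proof -
    have "T -` A \<inter> space content_measure = {y \<in> topspace Y. T y \<in> A}"
      by (auto simp: space_content_measure)
    with assms(2) that show ?thesis by simp
  qed
qed (use assms(1) compactin_subset_topspace in \<open>auto simp: space_content_measure\<close>)

text \<open>
  Preimages do not increase the measure, neither of a set nor of its complement. As the
  total mass is finite, neither can decrease.
\<close>
lemma measure_preserving_content_measure:
  assumes T: "continuous_map Y Y T"
    and inv: "\<And>G. openin Y G \<Longrightarrow> \<theta> {y \<in> topspace Y. T y \<in> G} = \<theta> G"
  shows "measure_preserving_map content_measure T"
proof -
  interpret finite_measure content_measure by (rule finite_content_measure)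
  have meas: "T \<in> measurable content_measure content_measure"
  proof (rule measurable_content_measure)
    show "T \<in> topspace Y \<rightarrow> topspace Y" using T by (simp add: continuous_map_def)
    fix K assume "compactin Y K"
    then have "closedin Y {y \<in> topspace Y. T y \<in> K}"
      using T compactin_imp_closedin[OF Hausdorff] by (intro closedin_continuous_map_preimage)
    then have "topspace Y - (topspace Y - {y \<in> topspace Y. T y \<in> K}) \<in> sets content_measure"
      using sets.top[of content_measure]
      by (intro sets.Diff openin_sets_content_measure) (auto simp: space_content_measure closedin_def)
    moreover have "topspace Y - (topspace Y - {y \<in> topspace Y. T y \<in> K}) = {y \<in> topspace Y. T y \<in> K}"
      by auto
    ultimately show "{y \<in> topspace Y. T y \<in> K} \<in> sets content_measure" by simp
  qed
  have le: "measure content_measure (T -` A \<inter> space content_measure) \<le> measure content_measure A"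
    if A: "A \<in> sets content_measure" for A
  proof -
    have pre: "T -` A \<inter> space content_measure = {y \<in> topspace Y. T y \<in> A}"
      by (auto simp: space_content_measure)
    have "emeasure content_measure (T -` A \<inter> space content_measure) \<le> emeasure content_measure A"
      unfolding emeasure_content_measure[OF A] emeasure_content_measure[OF measurable_sets[OF meas A]]
      unfolding pre using T inv by (rule outer_vimage_le)
    then show ?thesis by (simp add: emeasure_eq_measure)
  qed
  have eq: "measure content_measure (T -` A \<inter> space content_measure) = measure content_measure A"
    if A: "A \<in> sets content_measure" for A
  proof (rule antisym[OF le[OF A]])
    have "T -` (space content_measure - A) \<inter> space content_measure
        = space content_measure - (T -` A \<inter> space content_measure)"
      using measurable_space[OF meas] by auto
    with le[OF sets.compl_sets[OF A]]
    show "measure content_measure A \<le> measure content_measure (T -` A \<inter> space content_measure)"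
      using finite_measure_compl[OF A] finite_measure_compl[OF measurable_sets[OF meas A]] by simp
  qed
  show ?thesis
    by unfold_locales (use meas eq in auto)
qed

end

section \<open>Shift-invariant contents on the natural numbers\<close>

definition window_density :: "nat \<Rightarrow> nat \<Rightarrow> nat set \<Rightarrow> real"
  where "window_density s N B = real (card (B \<inter> {s..s + N})) / real (N + 1)"

lemma window_density_bounds: "window_density s N B \<in> {0..1}"
  using card_mono[of "{s..s + N}" "B \<inter> {s..s + N}"] by (simp add: window_density_def)

lemma window_density_Un_disjoint:
  assumes "disjnt B C"
  shows "window_density s N (B \<union> C) = window_density s N B + window_density s N C"
proof -
  have "card ((B \<union> C) \<inter> {s..s + N}) = card (B \<inter> {s..s + N}) + card (C \<inter> {s..s + N})"
    using assms by (subst card_Un_disjoint[symmetric]) (auto simp: disjnt_def Int_Un_distrib2)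
  then show ?thesis by (simp add: window_density_def add_divide_distrib)
qed

text \<open>
  Shifting a window by one removes one point and adds one point.
\<close>
lemma window_density_shift:
  "\<bar>window_density s N {n. Suc n \<in> B} - window_density s N B\<bar> \<le> 1 / real (N + 1)"
proof -
  have "card ({n. Suc n \<in> B} \<inter> {s..s + N}) = card (Suc ` ({n. Suc n \<in> B} \<inter> {s..s + N}))"
    by (simp add: card_image)
  also have "Suc ` ({n. Suc n \<in> B} \<inter> {s..s + N}) = B \<inter> {Suc s..Suc (s + N)}"
  proof (intro subset_antisym subsetI)
    fix k assume "k \<in> B \<inter> {Suc s..Suc (s + N)}"
    then show "k \<in> Suc ` ({n. Suc n \<in> B} \<inter> {s..s + N})" by (cases k) auto
  qed auto
  finally have shift: "card ({n. Suc n \<in> B} \<inter> {s..s + N}) = card (B \<inter> {Suc s..Suc (s + N)})" .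
  have "card (B \<inter> {Suc s..Suc (s + N)}) \<le> card (insert (Suc (s + N)) (B \<inter> {s..s + N}))"
    by (rule card_mono) auto
  also have "\<dots> \<le> Suc (card (B \<inter> {s..s + N}))" by (rule card_insert_le_m1) auto
  finally have 1: "card (B \<inter> {Suc s..Suc (s + N)}) \<le> Suc (card (B \<inter> {s..s + N}))" .
  have "card (B \<inter> {s..s + N}) \<le> card (insert s (B \<inter> {Suc s..Suc (s + N)}))"
    by (rule card_mono) auto
  also have "\<dots> \<le> Suc (card (B \<inter> {Suc s..Suc (s + N)}))" by (rule card_insert_le_m1) auto
  finally have 2: "card (B \<inter> {s..s + N}) \<le> Suc (card (B \<inter> {Suc s..Suc (s + N)}))" .
  have "\<bar>real (card ({n. Suc n \<in> B} \<inter> {s..s + N})) - real (card (B \<inter> {s..s + N}))\<bar> \<le> 1"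
    using 1 2 unfolding shift by linarith
  then show ?thesis
    unfolding window_density_def diff_divide_distrib[symmetric] abs_divide
    by (simp add: divide_right_mono)
qed

lemma dense_windows:
  assumes "upper_Banach_dens A > 0"
  obtains \<delta> N s where "0 < \<delta>" "\<And>k. k \<le> N k" "\<And>k. \<delta> \<le> window_density (s k) (N k) A"
proof -
  obtain \<delta> where \<delta>: "0 < ereal \<delta>" "ereal \<delta> < upper_Banach_dens A"
    using ereal_dense2[OF assms] by (auto simp: zero_ereal_def)
  have "\<exists>N s. k \<le> N \<and> \<delta> \<le> window_density s N A" for k
  proof (rule ccontr)
    assume *: "\<not> ?thesis"
    have "upper_Banach_dens A \<le> ereal \<delta>"
      unfolding upper_Banach_dens_def
    proof (intro Limsup_bounded eventually_mono[OF eventually_ge_at_top[of k]])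
      fix N assume "k \<le> N"
      have "Max (range (\<lambda>m. real (card (A \<inter> {m..m + N})) / real (N + 1)))
          \<in> range (\<lambda>m. real (card (A \<inter> {m..m + N})) / real (N + 1))"
        by (intro Max_in finite_window_densities) auto
      then obtain s where "Max (range (\<lambda>m. real (card (A \<inter> {m..m + N})) / real (N + 1)))
          = window_density s N A"
        unfolding window_density_def by blast
      moreover have "window_density s N A \<le> \<delta>"
        using * \<open>k \<le> N\<close> by (meson linear)
      ultimately show "ereal (Max (range (\<lambda>m. real (card (A \<inter> {m..m + N})) / real (N + 1)))) \<le> ereal \<delta>"
        by (simp only: ereal_less_eq)
    qed
    with \<delta>(2) show False by simp
  qed
  then obtain N s where "\<And>k. k \<le> N k" "\<And>k. \<delta> \<le> window_density (s k) (N k) A" by metis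
  with \<delta>(1) show ?thesis using that[of \<delta> N s] by (simp add: zero_ereal_def)
qed

lemma compact_unit_cube: "compact (PiE UNIV (\<lambda>_. {0..1}) :: ('i \<Rightarrow> real) set)"
proof -
  have "compactin (product_topology (\<lambda>_::'i. euclidean) UNIV) (PiE UNIV (\<lambda>_. {0..1::real}))"
    by (simp add: compactin_PiE)
  then show ?thesis by (simp only: euclidean_product_topology compactin_euclidean_iff)
qed

definition shift_invariant_content :: "(nat set \<Rightarrow> real) \<Rightarrow> bool"
  where "shift_invariant_content m \<longleftrightarrow> (\<forall>B. 0 \<le> m B)
    \<and> (\<forall>B C. disjnt B C \<longrightarrow> m (B \<union> C) = m B + m C) \<and> (\<forall>B. m {n. Suc n \<in> B} = m B)"

text \<open>
  Take a cluster point \<open>m\<close>, in the compact cube of all functions from \<open>nat set\<close> to the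
  unit interval, of the densities along windows that grow in length and in which \<open>A\<close> keeps density at
  least \<open>\<delta>\<close>. Every closed relation between finitely many values that holds for the window
  densities asymptotically passes to \<open>m\<close>.
\<close>
theorem exists_shift_invariant_content:
  assumes "upper_Banach_dens A > 0"
  shows "\<exists>m. shift_invariant_content m \<and> 0 < m A"
proof -
  obtain \<delta> N s where \<delta>: "0 < \<delta>" "\<And>k. k \<le> N k" "\<And>k. \<delta> \<le> window_density (s k) (N k) A"
    by (rule dense_windows[OF assms]) (rule that)
  define d where "d k = window_density (s k) (N k)" for k
  have "filtermap d sequentially \<noteq> bot" by (simp add: filtermap_bot_iff)
  moreover have "eventually (\<lambda>g. g \<in> PiE UNIV (\<lambda>_. {0..1})) (filtermap d sequentially)"
    using window_density_bounds by (auto simp: eventually_filtermap d_def intro!: always_eventually)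
  ultimately obtain m where "inf (nhds m) (filtermap d sequentially) \<noteq> bot"
    using compact_unit_cube unfolding compact_filter by blast
  \<comment> \<open>Along \<open>F\<close> the window densities of each single set converge to \<open>m\<close>.\<close>
  define F where "F = inf (nhds m) (filtermap d sequentially)"
  have F: "F \<noteq> bot" unfolding F_def by fact
  have ev: "eventually P F" if "eventually (\<lambda>k. P (d k)) sequentially" for P
    using that unfolding F_def by (intro filter_leD[OF inf_le2]) (simp add: eventually_filtermap)
  have "((\<lambda>g. g) \<longlongrightarrow> m) F"
    unfolding filterlim_def F_def by (simp add: filtermap_ident)
  then have lim: "((\<lambda>g. g B) \<longlongrightarrow> m B) F" for B
    by (rule continuous_on_tendsto_compose[OF continuous_on_product_coordinates]) simp_all
  show ?thesis
    unfolding shift_invariant_content_def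
  proof (intro exI[of _ m] conjI allI impI)
    show "0 \<le> m B" for B
      using window_density_bounds by (intro tendsto_lowerbound[OF lim _ F] ev always_eventually) (simp add: d_def)
    show "m (B \<union> C) = m B + m C" if "disjnt B C" for B C
    proof (rule tendsto_unique[OF F lim])
      have "eventually (\<lambda>g. g B + g C = g (B \<union> C)) F"
        using that by (intro ev) (simp add: d_def window_density_Un_disjoint)
      then show "((\<lambda>g. g (B \<union> C)) \<longlongrightarrow> m B + m C) F"
        by (rule Lim_transform_eventually[OF tendsto_add[OF lim lim]])
    qed
    show "m {n. Suc n \<in> B} = m B" for B
    proof -
      have "((\<lambda>g. \<bar>g {n. Suc n \<in> B} - g B\<bar>) \<longlongrightarrow> \<bar>m {n. Suc n \<in> B} - m B\<bar>) F"
        by (intro tendsto_intros lim)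
      then have "\<bar>m {n. Suc n \<in> B} - m B\<bar> \<le> 0 + e" if "0 < e" for e
      proof (rule tendsto_upperbound[OF _ _ F], intro ev)
        obtain k0 where k0: "inverse (real (Suc k0)) < e" using reals_Archimedean[OF \<open>0 < e\<close>] by blast
        show "eventually (\<lambda>k. \<bar>d k {n. Suc n \<in> B} - d k B\<bar> \<le> 0 + e) sequentially"
        proof (rule eventually_mono[OF eventually_ge_at_top[of k0]])
          fix k assume "k0 \<le> k"
          then have "1 / real (N k + 1) \<le> inverse (real (Suc k0))"
            using \<delta>(2)[of k] by (simp add: field_simps)
          then show "\<bar>d k {n. Suc n \<in> B} - d k B\<bar> \<le> 0 + e"
            using window_density_shift[of "s k" "N k" B] k0 unfolding d_def by linarith
        qed
      qed
      then have "\<bar>m {n. Suc n \<in> B} - m B\<bar> \<le> 0" by (rule field_le_epsilon)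
      then show ?thesis by simp
    qed
    have "\<delta> \<le> m A"
      using \<delta>(3) by (intro tendsto_lowerbound[OF lim _ F] ev always_eventually) (simp add: d_def)
    with \<delta>(1) show "0 < m A" by simp
  qed
qed

section \<open>Second countability and unions of compact sets\<close>

lemma separable_metrizable_imp_second_countable:
  assumes "metrizable_space X" "separable_space X"
  shows "second_countable X"
proof -
  obtain M d where "Metric_space M d" and X: "X = Metric_space.mtopology M d"
    using assms(1) unfolding metrizable_space_def by blast
  interpret Metric_space M d by fact
  obtain C where C: "countable C" "C \<subseteq> M" "mtopology closure_of C = M"
    using assms(2) unfolding separable_space_def X by auto
  define \<B> where "\<B> = (\<lambda>(c, n). mball c (inverse (real (Suc n)))) ` (C \<times> (UNIV :: nat set))"
  show ?thesis unfolding second_countable_def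
  proof (intro exI conjI ballI allI impI)
    show "countable \<B>" unfolding \<B>_def using C(1) by (intro countable_image countable_SIGMA) auto
    show "openin X V" if "V \<in> \<B>" for V using that by (auto simp: \<B>_def X)
    fix U x assume Ux: "openin X U \<and> x \<in> U"
    then obtain r where r: "r > 0" "mball x r \<subseteq> U" and "x \<in> M"
      unfolding X openin_mtopology by blast
    obtain n where n: "inverse (real (Suc n)) < r / 2"
      using reals_Archimedean[of "r / 2"] r(1) by auto
    define e where "e = inverse (real (Suc n))"
    have "0 < e" by (simp add: e_def)
    have "x \<in> mtopology closure_of C" using C(3) \<open>x \<in> M\<close> by simp
    then obtain c where c: "c \<in> C" "c \<in> mball x e"
      unfolding metric_closure_of using \<open>0 < e\<close> by auto
    have "mball c e \<subseteq> mball x r"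
    proof
      fix y assume "y \<in> mball c e"
      moreover have "d x y \<le> d x c + d c y" if "y \<in> M"
        using triangle[of x c y] c that by auto
      ultimately show "y \<in> mball x r" using c n by (auto simp: e_def)
    qed
    then have "x \<in> mball c e" "mball c e \<subseteq> U" using c r(2) by (auto simp: commute)
    moreover have "mball c e \<in> \<B>" using c(1) by (auto simp: \<B>_def e_def)
    ultimately show "\<exists>V\<in>\<B>. x \<in> V \<and> V \<subseteq> U" by blast
  qed
qed

text \<open>
  Countably many base sets \<open>B\<close>, each squeezed as \<open>B \<subseteq> K \<subseteq> U\<close> with \<open>K\<close> compact for
  \<open>Y\<close>, exhaust \<open>U\<close>.
\<close>
lemma openin_eq_UN_compact:
  assumes X: "second_countable X" and nb: "neighbourhood_base_of (compactin Y) X"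
    and U: "openin X U"
  shows "\<exists>K. (\<forall>n. compactin Y (K n)) \<and> incseq K \<and> (\<Union>n::nat. K n) = U"
proof -
  obtain \<B> where \<B>: "countable \<B>"
      and base: "\<And>U y. openin X U \<Longrightarrow> y \<in> U \<Longrightarrow> \<exists>V\<in>\<B>. y \<in> V \<and> V \<subseteq> U"
    using X unfolding second_countable_def by metis
  \<comment> \<open>The empty set is added so that the family can be enumerated even if \<open>U\<close> is empty.\<close>
  define \<C> where "\<C> = insert {} {B \<in> \<B>. \<exists>K. compactin Y K \<and> B \<subseteq> K \<and> K \<subseteq> U}"
  have "\<forall>B\<in>\<C>. \<exists>K. compactin Y K \<and> B \<subseteq> K \<and> K \<subseteq> U"
    unfolding \<C>_def using compactin_empty[of Y] by auto
  then obtain k where k: "\<And>B. B \<in> \<C> \<Longrightarrow> compactin Y (k B)" "\<And>B. B \<in> \<C> \<Longrightarrow> B \<subseteq> k B"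
      "\<And>B. B \<in> \<C> \<Longrightarrow> k B \<subseteq> U"
    by metis
  have \<C>: "countable \<C>" "\<C> \<noteq> {}" using \<B> by (auto simp: \<C>_def)
  have mem: "from_nat_into \<C> n \<in> \<C>" for n using \<C>(2) by (rule from_nat_into)
  define K where "K n = (\<Union>i\<le>n. k (from_nat_into \<C> i))" for n
  have "compactin Y (K n)" for n
    unfolding K_def using k(1)[OF mem] by (intro compactin_Union) auto
  moreover have "incseq K" unfolding K_def incseq_def by force
  moreover have "(\<Union>n. K n) = U"
  proof (intro subset_antisym subsetI)
    fix y assume "y \<in> (\<Union>n. K n)"
    then show "y \<in> U" unfolding K_def using k(3)[OF mem] by blast
  next
    fix y assume "y \<in> U"
    then obtain V C where V: "openin X V" "compactin Y C" "y \<in> V" "V \<subseteq> C" "C \<subseteq> U"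
      using nb U unfolding neighbourhood_base_of by metis
    then obtain B where B: "B \<in> \<B>" "y \<in> B" "B \<subseteq> V" using base[of V y] by auto
    then have "B \<in> \<C>" using V unfolding \<C>_def by blast
    then obtain i where "from_nat_into \<C> i = B" using \<C>(1) by (metis from_nat_into_surj)
    then have "y \<in> K i" using k(2)[OF \<open>B \<in> \<C>\<close>] B(2) unfolding K_def by blast
    then show "y \<in> (\<Union>n. K n)" by blast
  qed
  ultimately show ?thesis by blast
qed

section \<open>Invariant measures from recurrent orbits\<close>

lemma return_times_vimage:
  assumes "T \<in> S \<rightarrow> S" "x \<in> S"
  shows "return_times T x {y \<in> S. T y \<in> G} = {n. Suc n \<in> return_times T x G}"
proof -
  have "(T ^^ n) x \<in> S" for n using assms by (induction n) auto
  then show ?thesis by (auto simp: return_times_def)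
qed

text \<open>
  The content of a set \<open>G\<close> is the shift-invariant content of the set of times at which the
  orbit of \<open>x\<close> is in \<open>G\<close>; invariance under the shift of time becomes invariance under \<open>T\<close>.
  Preimages of open sets under \<open>T\<close> must be open for \<open>Y\<close> to get an invariant measure, and
  this is where continuity of \<open>T\<close> for the coarser topology enters. For \<open>T'\<close> continuity for
  \<open>X\<close> is enough, because the open sets of \<open>X\<close> are measurable too.
\<close>
theorem exists_invariant_measure:
  assumes X: "second_countable X" and T: "homeomorphic_maps X X T T'"
    and Y: "topspace Y = topspace X" "Hausdorff_space Y" "continuous_map Y Y T"
    and coarser: "\<And>U. openin Y U \<Longrightarrow> openin X U"
    and nb: "neighbourhood_base_of (compactin Y) X"
    and x: "x \<in> topspace X" and K: "compactin Y K"
    and dens: "upper_Banach_dens (return_times T x K) > 0"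
  obtains M where "measure_preserving_map M T" "measure_preserving_map M T'"
    "space M = topspace X" "Collect (openin X) \<subseteq> sets M"
    "K \<in> sets M" "emeasure M K > 0"
proof -
  obtain m where "shift_invariant_content m" and m_pos: "0 < m (return_times T x K)"
    using exists_shift_invariant_content[OF dens] by blast
  then have m: "\<And>B. 0 \<le> m B" "\<And>B C. disjnt B C \<Longrightarrow> m (B \<union> C) = m B + m C"
      "\<And>B. m {n. Suc n \<in> B} = m B"
    by (simp_all add: shift_invariant_content_def)
  define \<theta> where "\<theta> G = m (return_times T x G)" for G
  interpret sigma_compact_content Y \<theta>
  proof
    show "0 \<le> \<theta> A" for A by (simp add: \<theta>_def m(1))
    show "\<theta> (A \<union> B) = \<theta> A + \<theta> B" if "disjnt A B" for A B
    proof -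
      have "return_times T x (A \<union> B) = return_times T x A \<union> return_times T x B"
        by (auto simp: return_times_def)
      moreover have "disjnt (return_times T x A) (return_times T x B)"
        using that by (auto simp: return_times_def disjnt_iff)
      ultimately show ?thesis by (simp add: \<theta>_def m(2))
    qed
    show "\<exists>K. (\<forall>n. compactin Y (K n)) \<and> incseq K \<and> (\<Union>n::nat. K n) = G" if "openin Y G" for G
      using X nb coarser[OF that] by (rule openin_eq_UN_compact)
  qed (rule Y(2))
  have T_space: "T \<in> topspace Y \<rightarrow> topspace Y" using Y(3) by (simp add: continuous_map_def)
  have "\<theta> {y \<in> topspace Y. T y \<in> G} = \<theta> G" for G
    unfolding \<theta>_def using x return_times_vimage[OF T_space] by (simp add: Y(1) m(3))
  then have pres: "measure_preserving_map content_measure T"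
    using Y(3) by (intro measure_preserving_content_measure)
  have compact_sets: "C \<in> sets content_measure" if "compactin Y C" for C
    unfolding sets_content_measure using that by (intro sigma_sets.Basic) simp
  have open_sets: "U \<in> sets content_measure" if U: "openin X U" for U
  proof -
    obtain C where C: "\<And>n. compactin Y (C n)" "(\<Union>n::nat. C n) = U"
      using openin_eq_UN_compact[OF X nb U] by blast
    have "(\<Union>n. C n) \<in> sets content_measure"
      by (intro sets.countable_UN image_subsetI compact_sets C(1))
    with C(2) show ?thesis by simp
  qed
  have T'_cont: "continuous_map X X T'" and T'_inv: "\<And>y. y \<in> topspace X \<Longrightarrow> T' (T y) = y"
    using T by (auto simp: homeomorphic_maps_def)
  have "T' \<in> measurable content_measure content_measure"
  proof (rule measurable_content_measure)
    show "T' \<in> topspace Y \<rightarrow> topspace Y" using T'_cont by (simp add: continuous_map_def Y(1))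
    fix C assume "compactin Y C"
    then have "closedin Y C" using compactin_imp_closedin[OF Y(2)] by blast
    then have "closedin X C" using coarser by (auto simp: closedin_def Y(1))
    then have "closedin X {y \<in> topspace X. T' y \<in> C}"
      using T'_cont by (intro closedin_continuous_map_preimage)
    then have "topspace X - (topspace X - {y \<in> topspace X. T' y \<in> C}) \<in> sets content_measure"
      by (intro sets.Diff open_sets) (auto simp: closedin_def)
    moreover have "topspace X - (topspace X - {y \<in> topspace X. T' y \<in> C}) = {y \<in> topspace Y. T' y \<in> C}"
      by (auto simp: Y(1))
    ultimately show "{y \<in> topspace Y. T' y \<in> C} \<in> sets content_measure" by simp
  qed
  then have pres': "measure_preserving_map content_measure T'"
    using T'_inv by (intro measure_preserving_inverse[OF pres]) (simp_all add: space_content_measure Y(1))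
  have "0 < ennreal (\<theta> K)" using m_pos by (simp add: \<theta>_def)
  also have "\<dots> \<le> emeasure content_measure K"
    using content_le_outer_compact[OF K] emeasure_content_measure[OF compact_sets[OF K]] by simp
  finally have pos: "emeasure content_measure K > 0" .
  show thesis
    using pres pres' _ _ compact_sets[OF K] pos
    by (rule that) (auto simp: space_content_measure Y(1) open_sets)
qed

text \<open>
  Almost every point of the invariant measure is frequently recurrent in both time directions,
  and the measure charges a given neighbourhood of the reiteratively recurrent point.
\<close>
theorem RRec_subset_closure_FRec:
  assumes X: "second_countable X" and T: "homeomorphic_maps X X T T'"
    and Y: "topspace Y = topspace X" "Hausdorff_space Y" "continuous_map Y Y T"
    and coarser: "\<And>U. openin Y U \<Longrightarrow> openin X U"
    and nb: "neighbourhood_base_of (compactin Y) X"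
  shows "RRec X T \<subseteq> X closure_of (FRec X T \<inter> FRec X T')"
proof
  fix x assume x: "x \<in> RRec X T"
  then have "x \<in> topspace X" by (simp add: RRec_def)
  moreover have "\<exists>y. y \<in> FRec X T \<inter> FRec X T' \<and> y \<in> U" if U: "openin X U" "x \<in> U" for U
  proof -
    obtain V K where V: "openin X V" "compactin Y K" "x \<in> V" "V \<subseteq> K" "K \<subseteq> U"
      using nb U unfolding neighbourhood_base_of by metis
    then have "nbhd X x K"
      using openin_subset[OF U(1)] unfolding nbhd_def by blast
    then have dens: "upper_Banach_dens (return_times T x K) > 0"
      using x by (simp add: RRec_def)
    obtain M where M: "measure_preserving_map M T" "measure_preserving_map M T'"
        "space M = topspace X" "Collect (openin X) \<subseteq> sets M" "K \<in> sets M" "emeasure M K > 0"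
      using X T Y coarser nb \<open>x \<in> topspace X\<close> V(2) dens
      by (rule exists_invariant_measure)
    have rec: "AE y in M. y \<in> FRec X T" "AE y in M. y \<in> FRec X T'"
      using AE_frequently_recurrent_point[OF X M(1,3)] M(4)
        AE_frequently_recurrent_point[OF X M(2,3)] by auto
    show ?thesis
    proof (rule ccontr)
      assume *: "\<not> ?thesis"
      have "AE y in M. y \<notin> K"
        using rec by eventually_elim (use * V(5) in auto)
      then have "emeasure M K = 0"
        using M(5) AE_iff_measurable[of K M "\<lambda>y. y \<notin> K"] sets.sets_into_space[OF M(5)] by auto
      with M(6) show False by simp
    qed
  qed
  ultimately show "x \<in> X closure_of (FRec X T \<inter> FRec X T')"
    by (auto simp: in_closure_of)
qed

section \<open>Comparison of the sets of recurrent points\<close>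

lemma lower_dens_le_upper_Banach_dens: "lower_dens A \<le> upper_Banach_dens A"
proof -
  have "lower_dens A \<le> limsup (\<lambda>N. ereal (real (card (A \<inter> {0..N})) / real (N + 1)))"
    unfolding lower_dens_def by (rule Liminf_le_Limsup) simp
  also have "\<dots> \<le> upper_Banach_dens A"
    unfolding upper_Banach_dens_def
  proof (intro Limsup_mono always_eventually allI)
    fix N
    have "real (card (A \<inter> {0..0 + N})) / real (N + 1)
        \<le> Max (range (\<lambda>m. real (card (A \<inter> {m..m + N})) / real (N + 1)))"
      by (rule Max_ge[OF finite_window_densities]) (rule rangeI)
    then show "ereal (real (card (A \<inter> {0..N})) / real (N + 1))
        \<le> ereal (Max (range (\<lambda>m. real (card (A \<inter> {m..m + N})) / real (N + 1))))"
      by (simp only: ereal_less_eq add_0)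
  qed
  finally show ?thesis .
qed

lemma FRec_subset_RRec: "FRec X S \<subseteq> RRec X S"
proof
  fix x assume x: "x \<in> FRec X S"
  have "upper_Banach_dens (return_times S x U) > 0" if "nbhd X x U" for U
  proof -
    have "lower_dens (return_times S x U) > 0" using x that by (simp add: FRec_def)
    then show ?thesis using lower_dens_le_upper_Banach_dens by (rule less_le_trans)
  qed
  with x show "x \<in> RRec X S" by (simp add: RRec_def FRec_def)
qed

theorem theorem6p3:
  fixes X X1 :: "'a topology" and T T' :: "'a \<Rightarrow> 'a"
  assumes "Polish_space X"
    and "homeomorphic_maps X X T T'"
    and "topspace X1 = topspace X"
    and "Hausdorff_space X1"
    and "continuous_map X1 X1 T"
    and "\<forall>U. openin X1 U \<longrightarrow> openin X U"
    and "neighbourhood_base_of (compactin X1) X"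
  shows "(X closure_of FRec X T = X closure_of RRec X T
          \<and> X closure_of RRec X T \<subseteq> X closure_of FRec X T'
          \<and> X closure_of FRec X T' \<subseteq> X closure_of RRec X T')
    \<and> (reiteratively_recurrent X T \<longrightarrow> frequently_recurrent X T')
    \<and> (RRec X T \<noteq> {} \<longrightarrow> FRec X T \<inter> FRec X T' \<noteq> {})
    \<and> ((\<exists>X2 :: 'a topology. topspace X2 = topspace X \<and> Hausdorff_space X2
            \<and> continuous_map X2 X2 T' \<and> (\<forall>U. openin X2 U \<longrightarrow> openin X U)
            \<and> neighbourhood_base_of (compactin X2) X)
        \<longrightarrow> (X closure_of FRec X T = X closure_of RRec X T
             \<and> X closure_of RRec X T = X closure_of FRec X T'
             \<and> X closure_of FRec X T' = X closure_of RRec X T')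
          \<and> (reiteratively_recurrent X T \<longleftrightarrow> reiteratively_recurrent X T')
          \<and> (reiteratively_recurrent X T \<longleftrightarrow> frequently_recurrent X T)
          \<and> (reiteratively_recurrent X T' \<longleftrightarrow> frequently_recurrent X T'))"
proof -
  have X: "second_countable X"
    using assms(1) by (auto simp: Polish_space_def completely_metrizable_imp_metrizable_space
        intro: separable_metrizable_imp_second_countable)
  have T': "homeomorphic_maps X X T' T"
    using assms(2) by (subst homeomorphic_maps_sym)
  have FR: "X closure_of FRec X S \<subseteq> X closure_of RRec X S" for S
    by (rule closure_of_mono[OF FRec_subset_RRec])
  have "RRec X T \<subseteq> X closure_of (FRec X T \<inter> FRec X T')"
    using X assms(2-5) assms(6)[rule_format] assms(7) by (rule RRec_subset_closure_FRec)
  then have main: "X closure_of RRec X T \<subseteq> X closure_of (FRec X T \<inter> FRec X T')"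
    by (rule closure_of_minimal) simp
  have T_F: "X closure_of RRec X T \<subseteq> X closure_of FRec X T"
    and T_F': "X closure_of RRec X T \<subseteq> X closure_of FRec X T'"
    using main closure_of_mono[of "FRec X T \<inter> FRec X T'"] by (meson Int_lower1 Int_lower2 order_trans)+
  have a: "frequently_recurrent X T'" if "reiteratively_recurrent X T"
    using that T_F' closure_of_subset_topspace[of X "FRec X T'"]
    by (auto simp: frequently_recurrent_def reiteratively_recurrent_def)
  have b: "FRec X T \<inter> FRec X T' \<noteq> {}" if "RRec X T \<noteq> {}"
  proof
    assume "FRec X T \<inter> FRec X T' = {}"
    then have "RRec X T \<subseteq> {}"
      using \<open>RRec X T \<subseteq> X closure_of (FRec X T \<inter> FRec X T')\<close> by simp
    with that show False by simp
  qed
  have c: "X closure_of RRec X T' \<subseteq> X closure_of FRec X T"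
    if X2: "topspace X2 = topspace X" "Hausdorff_space X2" "continuous_map X2 X2 T'"
      "\<forall>U. openin X2 U \<longrightarrow> openin X U" "neighbourhood_base_of (compactin X2) X" for X2
  proof -
    have "RRec X T' \<subseteq> X closure_of (FRec X T' \<inter> FRec X T)"
      using X T' X2(1-3) X2(4)[rule_format] X2(5) by (rule RRec_subset_closure_FRec)
    also have "\<dots> \<subseteq> X closure_of FRec X T" by (rule closure_of_mono) simp
    finally show ?thesis by (rule closure_of_minimal) simp
  qed
  have all_eq: "X closure_of FRec X T = X closure_of RRec X T
      \<and> X closure_of RRec X T = X closure_of FRec X T'
      \<and> X closure_of FRec X T' = X closure_of RRec X T'"
    if "X closure_of RRec X T' \<subseteq> X closure_of FRec X T"
    using that FR[of T] FR[of T'] T_F T_F' by blast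
  show ?thesis
  proof (intro conjI impI)
    show "X closure_of FRec X T = X closure_of RRec X T"
      using FR T_F by (rule subset_antisym)
    show "frequently_recurrent X T'" if "reiteratively_recurrent X T" using that by (rule a)
    show "FRec X T \<inter> FRec X T' \<noteq> {}" if "RRec X T \<noteq> {}" using that by (rule b)
  qed (use all_eq c in \<open>auto simp: T_F' FR reiteratively_recurrent_def frequently_recurrent_def\<close>)
qed

end
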